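(* Let $C_{\varphi,\psi}$ be a Marshall copula with generating functions $\varphi,\psi$, and let $F_U$ and $F_V$ be two distribution functions on $\mathbb{R}$ that satisfy the following assumptions. (a) There is an increasing function $\chi:\mathbb{R}\to\mathbb{R}$ such that for every $x\in\mathbb{R}$ with $F_U(\chi(x))>0$ and $F_V(x)>0$, \[\varphi^*(F_U(\chi(x)))=\psi^*(F_V(x)).\] (b) Either $\varphi$ is continuous at $0$, or $x_U=\inf\{x\in\mathbb{R}:F_U(x)>0\}>-\infty$ and $F_U$ is not continuous at $x_U$. Either $\psi$ is continuous at $0$, or $x_V=\inf\{x\in\mathbb{R}:F_V(x)>0\}>-\infty$ and $F_V$ is not continuous at $x_V$. (c) Either $\varphi^*(0+)=\infty$ or there is $x\in\mathbb{R}$ with $F_U(x)=0$. Either $\psi^*(0+)=\infty$ or there is $x\in\mathbb{R}$ with $F_V(x)=0$. Then there are random variables $X,Y,Z_1,Z_2$ such that $X,Y,Z_1$ are independent, $X,Y,Z_2$ are independent, $Z_1$ and $Z_2$ are comonotonic, and $H(x,y)=C_{\varphi,\psi}(F_U(x),F_V(y))$ is the joint distribution function of \[U=\max\{X,Z_1\}\quad\text{and}\quad V=\max\{Y,Z_2\}.\]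
   Context: A Marshall copula is a function on $[0,1]^2$ of the form $C_{\varphi,\psi}(u,v)=\min\{u\psi(v),\varphi(u)v\}$, where each of the generating functions $\varphi,\psi:[0,1]\to[0,1]$ satisfies (stated for $\varphi$): $\varphi(0)=0$, $\varphi(1)=1$; $\varphi$ is nondecreasing on $[0,1]$; and $\varphi^*(u)=\varphi(u)/u$ is nonincreasing on $(0,1]$. Similarly $\psi^*(v)=\psi(v)/v$ on $(0,1]$. $\varphi^*(0+)$ denotes the right limit of $\varphi^*$ at $0$. Distribution functions are $F_W(x)=\mathbb{P}[W\le x]$. Random variables $Z_1,Z_2$ with distribution functions $G_1,G_2$ are comonotonic if $\mathbb{P}[Z_1\le x,Z_2\le y]=\min\{G_1(x),G_2(y)\}$ for all $x,y$. *)

theory Defs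
  imports "HOL-Probability.Probability"
begin

definition marshall_star :: "(real \<Rightarrow> real) \<Rightarrow> real \<Rightarrow> real" where
  "marshall_star \<phi> u = \<phi> u / u"

text \<open>A function \<open>[0,1] \<rightarrow> [0,1]\<close> is represented by a function on \<open>real\<close> whose values
  outside \<open>[0,1]\<close> are irrelevant.\<close>

definition marshall_generator :: "(real \<Rightarrow> real) \<Rightarrow> bool" where
  "marshall_generator \<phi> \<longleftrightarrow>
     \<phi> \<in> {0..1} \<rightarrow> {0..1} \<and> \<phi> 0 = 0 \<and> \<phi> 1 = 1 \<and>
     mono_on {0..1} \<phi> \<and> antimono_on {0<..1} (marshall_star \<phi>)"

definition marshall_copula :: "(real \<Rightarrow> real) \<Rightarrow> (real \<Rightarrow> real) \<Rightarrow> real \<Rightarrow> real \<Rightarrow> real" where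
  "marshall_copula \<phi> \<psi> u v = min (u * \<psi> v) (\<phi> u * v)"

definition distribution_function :: "(real \<Rightarrow> real) \<Rightarrow> bool" where
  "distribution_function F \<longleftrightarrow> (\<exists>\<mu>. real_distribution \<mu> \<and> F = cdf \<mu>)"

text \<open>The infimum is taken in the extended reals, so that it is \<open>-\<infinity>\<close> when the set is
  unbounded below.\<close>

definition left_endpoint :: "(real \<Rightarrow> real) \<Rightarrow> ereal" where
  "left_endpoint F = Inf (ereal ` {x. F x > 0})"

definition joint_cdf ::
    "'a measure \<Rightarrow> ('a \<Rightarrow> real) \<Rightarrow> ('a \<Rightarrow> real) \<Rightarrow> real \<Rightarrow> real \<Rightarrow> real" where
  "joint_cdf M U V x y = measure M {\<omega> \<in> space M. U \<omega> \<le> x \<and> V \<omega> \<le> y}"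

definition comonotonic :: "'a measure \<Rightarrow> ('a \<Rightarrow> real) \<Rightarrow> ('a \<Rightarrow> real) \<Rightarrow> bool" where
  "comonotonic M Z1 Z2 \<longleftrightarrow>
     (\<forall>x y. joint_cdf M Z1 Z2 x y = min (cdf (distr M borel Z1) x) (cdf (distr M borel Z2) y))"

definition indep3 ::
    "'a measure \<Rightarrow> ('a \<Rightarrow> real) \<Rightarrow> ('a \<Rightarrow> real) \<Rightarrow> ('a \<Rightarrow> real) \<Rightarrow> bool" where
  "indep3 M X Y Z \<longleftrightarrow>
     prob_space.indep_vars M (\<lambda>_. borel) (\<lambda>i. [X, Y, Z] ! i) {..<3}"

end

theory Submission imports Defs begin

text \<open>
  For \<open>u, v > 0\<close> we have \<open>C(u, v) = \<phi> u * \<psi> v * min (u / \<phi> u) (v / \<psi> v)\<close>. So one takes \<open>X\<close> and \<open>Y\<close>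
  with distribution functions \<open>\<phi> \<circ> F_U\<close> and \<open>\<psi> \<circ> F_V\<close>, and independently of them a comonotonic
  pair \<open>(Z1, Z2)\<close> whose distribution functions are \<open>F_U / (\<phi> \<circ> F_U)\<close> and \<open>F_V / (\<psi> \<circ> F_V)\<close>
  wherever \<open>F_U\<close> and \<open>F_V\<close> are positive. Where \<open>F_U\<close> vanishes, \<open>\<phi> \<circ> F_U\<close> vanishes too, so there the
  distribution function of \<open>Z1\<close> may be chosen freely. Condition (b) makes \<open>\<phi> \<circ> F_U\<close> a distribution
  function, and condition (c) does the same for the distribution function of \<open>Z1\<close>.
\<close>

section \<open>Distribution functions and their compositions with functions on [0,1]\<close>

lemma distribution_function_iff:
  "distribution_function F \<longleftrightarrow>
     mono F \<and> (\<forall>a. continuous (at_right a) F) \<and> (F \<longlongrightarrow> 0) at_bot \<and> (F \<longlongrightarrow> 1) at_top"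
proof
  assume "distribution_function F"
  then obtain \<mu> where "real_distribution \<mu>" and F: "F = cdf \<mu>"
    by (auto simp: distribution_function_def)
  then interpret cdf_distribution \<mu> by (simp add: cdf_distribution_def)
  show "mono F \<and> (\<forall>a. continuous (at_right a) F) \<and> (F \<longlongrightarrow> 0) at_bot \<and> (F \<longlongrightarrow> 1) at_top"
    using mono cont bot top by (simp add: F)
next
  assume "mono F \<and> (\<forall>a. continuous (at_right a) F) \<and> (F \<longlongrightarrow> 0) at_bot \<and> (F \<longlongrightarrow> 1) at_top"
  then have "real_distribution (interval_measure F)" "cdf (interval_measure F) = F"
    by (auto intro!: real_distribution_interval_measure cdf_interval_measure simp: mono_def)
  then show "distribution_function F"
    by (metis distribution_function_def)
qed

lemma distribution_function_range:
  assumes "distribution_function F"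
  shows "F x \<in> {0..1}"
proof -
  obtain \<mu> where "real_distribution \<mu>" and F: "F = cdf \<mu>"
    using assms by (auto simp: distribution_function_def)
  then interpret real_distribution \<mu> by simp
  show ?thesis by (simp add: F cdf_nonneg cdf_bounded_prob)
qed

lemma continuous_at_right_compose_distribution_function:
  assumes F: "distribution_function F" and f: "continuous (at (F x) within {F x..1}) f"
  shows "continuous (at_right x) (\<lambda>t. f (F t))"
  unfolding continuous_within
proof (rule continuous_within_tendsto_compose[OF f])
  show "\<forall>\<^sub>F t in at_right x. F t \<in> {F x..1}"
    using F distribution_function_range[OF F]
    by (auto simp: eventually_at_filter distribution_function_iff mono_def)
  show "(F \<longlongrightarrow> F x) (at_right x)"
    using F by (simp add: distribution_function_iff continuous_within)
qed

lemma tendsto_at_bot_compose_distribution_function: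
  assumes F: "distribution_function F" and f: "continuous (at 0 within {0..1}) f"
  shows "((\<lambda>t. f (F t)) \<longlongrightarrow> f 0) at_bot"
proof (rule continuous_within_tendsto_compose[OF f])
  show "\<forall>\<^sub>F t in at_bot. F t \<in> {0..1}"
    using distribution_function_range[OF F] by simp
  show "(F \<longlongrightarrow> 0) at_bot"
    using F by (simp add: distribution_function_iff)
qed

text \<open>Once \<open>F t\<close> is positive, \<open>f (F t)\<close> is squeezed between
  \<open>F t\<close> and 1. Both a generator and the ratio \<open>u / \<phi> u\<close> satisfy the
  bounds on \<open>f\<close>.\<close>

lemma tendsto_at_top_compose_distribution_function:
  assumes F: "distribution_function F"
    and f: "\<And>u. 0 < u \<Longrightarrow> u \<le> 1 \<Longrightarrow> u \<le> f u \<and> f u \<le> (1::real)"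
  shows "((\<lambda>t. f (F t)) \<longlongrightarrow> 1) at_top"
proof (rule tendsto_sandwich)
  have top: "(F \<longlongrightarrow> 1) at_top"
    using F by (simp add: distribution_function_iff)
  have pos: "\<forall>\<^sub>F t in at_top. 0 < F t"
    using order_tendstoD(1)[OF top, of 0] by simp
  show "(F \<longlongrightarrow> 1) at_top" by (rule top)
  show "\<forall>\<^sub>F t in at_top. F t \<le> f (F t)" "\<forall>\<^sub>F t in at_top. f (F t) \<le> 1"
    using pos f distribution_function_range[OF F] by (auto elim!: eventually_mono)
qed simp

lemma distribution_function_eq_0_lessThan_left_endpoint:
  assumes F: "distribution_function F"
    and x: "left_endpoint F > -\<infinity>" "x < real_of_ereal (left_endpoint F)"
  shows "F x = 0"
proof (rule ccontr)
  assume "F x \<noteq> 0"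
  then have "F x > 0"
    using distribution_function_range[OF F, of x] by simp
  then have "left_endpoint F \<le> ereal x"
    by (auto simp: left_endpoint_def intro!: Inf_lower)
  then show False
    \<comment> \<open>A finite endpoint would be at most \<open>x\<close>, the value \<infinity>
      contradicts the bound just derived, and -\<infinity> is excluded by hypothesis.\<close>
    using x by (cases "left_endpoint F") auto
qed

text \<open>If \<open>F\<close> vanished at this point, monotonicity would make it vanish everywhere
  to the left; together with right continuity this would give continuity there.\<close>

lemma distribution_function_left_endpoint_pos:
  assumes F: "distribution_function F"
    and "\<not> isCont F (real_of_ereal (left_endpoint F))"
  shows "F (real_of_ereal (left_endpoint F)) > 0"
proof (rule ccontr)
  define x where "x = real_of_ereal (left_endpoint F)"
  assume "\<not> F (real_of_ereal (left_endpoint F)) > 0"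
  then have Fx: "F x = 0"
    using distribution_function_range[OF F, of x] by (simp add: x_def)
  have "F t = 0" if "t < x" for t
  proof -
    have "F t \<le> F x"
      using F that by (simp add: distribution_function_iff mono_def)
    then show ?thesis
      using Fx distribution_function_range[OF F, of t] by simp
  qed
  then have "\<forall>\<^sub>F t in at_left x. F t = F x"
    by (simp add: eventually_at_filter Fx)
  then have "continuous (at_left x) F"
    by (simp add: continuous_within tendsto_eventually)
  moreover have "continuous (at_right x) F"
    using F by (simp add: distribution_function_iff)
  ultimately show False
    using assms(2) by (simp add: continuous_at_split x_def)
qed

section \<open>Marshall generators and the reciprocals of their star functions\<close>

lemma marshall_generator_bounds:
  assumes \<phi>: "marshall_generator \<phi>" and u: "0 < u" "u \<le> 1"
  shows "u \<le> \<phi> u" "\<phi> u \<le> 1" "0 < \<phi> u"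
proof -
  \<comment> \<open>The left-hand side is 1, so this comparison is the lower bound on
    \<open>\<phi> u\<close>.\<close>
  have "marshall_star \<phi> 1 \<le> marshall_star \<phi> u"
    using \<phi> u monotone_onD[of "{0<..1}" "(\<le>)" "(\<ge>)" "marshall_star \<phi>" u 1]
    by (auto simp: marshall_generator_def)
  then show "u \<le> \<phi> u"
    using \<phi> u by (simp add: marshall_star_def marshall_generator_def field_simps)
  then show "0 < \<phi> u" using u by simp
  show "\<phi> u \<le> 1" using \<phi> u by (auto simp: marshall_generator_def Pi_def)
qed

lemma marshall_generator_mono:
  assumes "marshall_generator \<phi>" "0 \<le> u" "u \<le> v" "v \<le> 1"
  shows "\<phi> u \<le> \<phi> v"
  using assms by (auto simp: marshall_generator_def intro: mono_onD)

lemma marshall_generator_antimono_ratio: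
  assumes "marshall_generator \<phi>" "0 < u" "u \<le> v" "v \<le> 1"
  shows "\<phi> v / v \<le> \<phi> u / u"
  using assms monotone_onD[of "{0<..1}" "(\<le>)" "(\<ge>)" "marshall_star \<phi>" u v]
  by (auto simp: marshall_generator_def marshall_star_def)

text \<open>To the right of \<open>u\<close>, monotonicity bounds \<phi> below by the constant
  \<open>\<phi> u\<close>, and the antitone star function bounds it above by the line through the
  origin and \<open>(u, \<phi> u)\<close>. Both bounds meet at \<open>u\<close>. At 0 there is no
  such line, and a generator may jump there.\<close>

lemma marshall_generator_right_continuous:
  assumes \<phi>: "marshall_generator \<phi>" and u: "0 < u" "u \<le> 1"
  shows "continuous (at u within {u..1}) \<phi>"
  unfolding continuous_within
proof (rule tendsto_sandwich)
  show "\<forall>\<^sub>F v in at u within {u..1}. \<phi> u \<le> \<phi> v"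
    using marshall_generator_mono[OF \<phi>, of u] u by (auto simp: eventually_at_filter)
  have "\<phi> v \<le> \<phi> u / u * v" if "v \<in> {u..1}" for v
    using marshall_generator_antimono_ratio[OF \<phi>, of u v] u that by (simp add: field_simps)
  then show "\<forall>\<^sub>F v in at u within {u..1}. \<phi> v \<le> \<phi> u / u * v"
    by (simp add: eventually_at_filter)
  have "((\<lambda>v. \<phi> u / u * v) \<longlongrightarrow> \<phi> u / u * u) (at u within {u..1})"
    by (intro tendsto_intros)
  then show "((\<lambda>v. \<phi> u / u * v) \<longlongrightarrow> \<phi> u) (at u within {u..1})"
    using u by simp
qed simp

text \<open>The value at \<open>0\<close> is the right limit, in place of the junk value \<open>0 / \<phi> 0 = 0\<close>.\<close>

definition marshall_ratio :: "(real \<Rightarrow> real) \<Rightarrow> real \<Rightarrow> real" where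
  "marshall_ratio \<phi> u = (if u = 0 then INF v\<in>{0<..1}. v / \<phi> v else u / \<phi> u)"

lemma marshall_ratio_bounds:
  assumes "marshall_generator \<phi>" and "0 < u" "u \<le> 1"
  shows "u \<le> marshall_ratio \<phi> u" "marshall_ratio \<phi> u \<le> 1"
  using marshall_generator_bounds[OF assms] assms(2)
  by (auto simp: marshall_ratio_def field_simps mult_left_le)

lemma bdd_below_marshall_ratio:
  assumes "marshall_generator \<phi>"
  shows "bdd_below ((\<lambda>v. v / \<phi> v) ` {0<..1})"
proof (rule bdd_belowI2)
  show "0 \<le> v / \<phi> v" if "v \<in> {0<..1}" for v
    using marshall_generator_bounds[OF assms, of v] that by simp
qed

lemma marshall_ratio_0_nonneg:
  assumes "marshall_generator \<phi>"
  shows "0 \<le> marshall_ratio \<phi> 0"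
  unfolding marshall_ratio_def if_P[OF refl]
proof (rule cINF_greatest)
  show "0 \<le> v / \<phi> v" if "v \<in> {0<..1}" for v
    using marshall_generator_bounds[OF assms, of v] that by simp
qed simp

lemma marshall_ratio_mono:
  assumes \<phi>: "marshall_generator \<phi>" and "0 \<le> u" "u \<le> v" "v \<le> 1"
  shows "marshall_ratio \<phi> u \<le> marshall_ratio \<phi> v"
proof (cases "u = 0")
  case True
  show ?thesis
  proof (cases "v = 0")
    case False
    then have "(INF v\<in>{0<..1}. v / \<phi> v) \<le> v / \<phi> v"
      using assms by (intro cINF_lower bdd_below_marshall_ratio) auto
    then show ?thesis using True False by (simp add: marshall_ratio_def)
  qed (use True in simp)
next
  case False
  then show ?thesis
    using marshall_generator_antimono_ratio[OF \<phi>, of u v] assms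
      marshall_generator_bounds[OF \<phi>, of u] marshall_generator_bounds[OF \<phi>, of v]
    by (simp add: marshall_ratio_def field_simps)
qed

text \<open>At 0 the value is the infimum of a nondecreasing function, hence its right limit, even
  if \<phi> jumps there. At positive \<open>u\<close> the quotient inherits right continuity from
  \<phi>.\<close>

lemma marshall_ratio_right_continuous:
  assumes \<phi>: "marshall_generator \<phi>" and u: "0 \<le> u" "u \<le> 1"
  shows "continuous (at u within {u..1}) (marshall_ratio \<phi>)"
  unfolding continuous_within
proof (cases "u = 0")
  case True
  show "(marshall_ratio \<phi> \<longlongrightarrow> marshall_ratio \<phi> u) (at u within {u..1})"
    unfolding True
  proof (rule order_tendstoI)
    fix y assume "y < marshall_ratio \<phi> 0"
    then have "y < marshall_ratio \<phi> v" if "v \<in> {0..1}" for v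
      using marshall_ratio_mono[OF \<phi>, of 0 v] that by simp
    then show "\<forall>\<^sub>F v in at 0 within {0..1}. y < marshall_ratio \<phi> v"
      by (simp add: eventually_at_filter)
  next
    fix y assume "marshall_ratio \<phi> 0 < y"
    then have "(INF v\<in>{0<..1}. v / \<phi> v) < y"
      by (simp add: marshall_ratio_def)
    then obtain w where w: "0 < w" "w \<le> 1" "w / \<phi> w < y"
      by (subst (asm) cINF_less_iff) (auto intro: bdd_below_marshall_ratio \<phi>)
    have "marshall_ratio \<phi> v < y" if "v \<in> {0..1}" "v < w" for v
      using marshall_ratio_mono[OF \<phi>, of v w] that w by (simp add: marshall_ratio_def split: if_splits)
    moreover have "\<forall>\<^sub>F v in at 0 within {0..1}. v \<in> {0..1} \<and> v < w"
      using eventually_nhds_in_open[of "{..<w}" 0] w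
      by (auto simp: eventually_at_filter elim: eventually_mono)
    ultimately show "\<forall>\<^sub>F v in at 0 within {0..1}. marshall_ratio \<phi> v < y"
      by (auto elim: eventually_mono)
  qed
next
  case False
  with u have u: "0 < u" "u \<le> 1" by auto
  have "((\<lambda>v. v / \<phi> v) \<longlongrightarrow> u / \<phi> u) (at u within {u..1})"
    using marshall_generator_right_continuous[OF \<phi> u] marshall_generator_bounds[OF \<phi> u]
    by (intro tendsto_intros) (auto simp: continuous_within)
  moreover have "\<forall>\<^sub>F v in at u within {u..1}. v / \<phi> v = marshall_ratio \<phi> v"
    using u by (auto simp: eventually_at_filter marshall_ratio_def)
  ultimately have "(marshall_ratio \<phi> \<longlongrightarrow> u / \<phi> u) (at u within {u..1})"
    by (rule Lim_transform_eventually)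
  then show "(marshall_ratio \<phi> \<longlongrightarrow> marshall_ratio \<phi> u) (at u within {u..1})"
    using u by (simp add: marshall_ratio_def)
qed

text \<open>On (0,1] the ratio is the reciprocal of the star function, so it tends to 0 when the
  latter tends to infinity, and by monotonicity its value at 0 lies below all of these.\<close>

lemma marshall_ratio_0_eq_0:
  assumes \<phi>: "marshall_generator \<phi>" and lim: "filterlim (marshall_star \<phi>) at_top (at_right 0)"
  shows "marshall_ratio \<phi> 0 = 0"
proof (rule antisym)
  have "((\<lambda>u. inverse (marshall_star \<phi> u)) \<longlongrightarrow> 0) (at_right 0)"
    by (rule tendsto_inverse_0_at_top[OF lim])
  moreover have "\<forall>\<^sub>F u in at_right 0. marshall_ratio \<phi> 0 \<le> inverse (marshall_star \<phi> u)"
    using eventually_at_right_real[of 0 "1::real"]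
  proof (rule eventually_mono)
    fix u :: real assume "u \<in> {0<..<1}"
    then show "marshall_ratio \<phi> 0 \<le> inverse (marshall_star \<phi> u)"
      using marshall_ratio_mono[OF \<phi>, of 0 u] by (simp add: marshall_ratio_def marshall_star_def)
  qed simp
  ultimately show "marshall_ratio \<phi> 0 \<le> 0"
    by (intro tendsto_lowerbound) auto
qed (rule marshall_ratio_0_nonneg[OF \<phi>])

section \<open>The marginal distribution functions of X, Y, Z1 and Z2\<close>

text \<open>The only obstacle is a jump of \<phi> at 0. In that case (b) makes \<open>F\<close> jump
  from 0 straight to a positive value at its left endpoint, so \<open>F\<close> never approaches 0
  through positive values.\<close>

lemma distribution_function_marshall_generator:
  assumes \<phi>: "marshall_generator \<phi>" and F: "distribution_function F"
    and b: "continuous (at 0 within {0..1}) \<phi> \<or>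
          left_endpoint F > -\<infinity> \<and> \<not> isCont F (real_of_ereal (left_endpoint F))"
  shows "distribution_function (\<lambda>x. \<phi> (F x))"
  unfolding distribution_function_iff
proof (intro conjI allI)
  define x0 where "x0 = real_of_ereal (left_endpoint F)"
  have mono: "F x \<le> F y" if "x \<le> y" for x y
    using F that by (simp add: distribution_function_iff mono_def)
  have \<phi>0: "\<phi> 0 = 0" using \<phi> by (simp add: marshall_generator_def)
  note r = distribution_function_range[OF F]
  show "mono (\<lambda>x. \<phi> (F x))"
    using r by (auto intro!: monoI marshall_generator_mono[OF \<phi>] mono)
  show "((\<lambda>x. \<phi> (F x)) \<longlongrightarrow> 1) at_top"
    using marshall_generator_bounds[OF \<phi>]
    by (intro tendsto_at_top_compose_distribution_function[OF F]) auto
  have jump: "F x0 > 0" "\<And>x. x < x0 \<Longrightarrow> F x = 0" if "\<not> continuous (at 0 within {0..1}) \<phi>"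
    using that b distribution_function_left_endpoint_pos[OF F]
      distribution_function_eq_0_lessThan_left_endpoint[OF F] by (auto simp: x0_def)
  show "((\<lambda>x. \<phi> (F x)) \<longlongrightarrow> 0) at_bot"
  proof (cases "continuous (at 0 within {0..1}) \<phi>")
    case True
    then show ?thesis
      using tendsto_at_bot_compose_distribution_function[OF F True] \<phi>0 by simp
  next
    case False
    have "\<forall>\<^sub>F x in at_bot. \<phi> (F x) = 0"
      using eventually_gt_at_bot[of x0]
      by (rule eventually_mono) (simp add: jump(2)[OF False] \<phi>0)
    then show ?thesis by (rule tendsto_eventually)
  qed
  fix x
  show "continuous (at_right x) (\<lambda>x. \<phi> (F x))"
  proof (cases "F x = 0 \<and> \<not> continuous (at 0 within {0..1}) \<phi>")
    case True
    \<comment> \<open>\<open>F\<close> vanishes at \<open>x\<close> but not at \<open>x0\<close>, so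
      it is constantly 0 on a right neighbourhood of \<open>x\<close>.\<close>
    then have "x < x0"
      using jump(1) mono[of x0 x] by force
    then have "\<forall>\<^sub>F t in at_right x. \<phi> (F t) = \<phi> (F x)"
      using eventually_at_right_real[of x x0] jump(2) True by (auto elim!: eventually_mono)
    then show ?thesis
      by (simp add: continuous_within tendsto_eventually)
  next
    case False
    then have "continuous (at (F x) within {F x..1}) \<phi>"
      using r[of x] marshall_generator_right_continuous[OF \<phi>, of "F x"] by (cases "F x = 0") auto
    then show ?thesis
      by (rule continuous_at_right_compose_distribution_function[OF F])
  qed
qed

text \<open>The ratio composed with \<open>F\<close> has every required property except possibly the
  limit 0 at -\<infinity>, since \<open>marshall_ratio \<phi> 0\<close> may be positive. Either that
  value is 0 by (c), or \<open>F\<close> has a zero and the function can be cut off there.\<close>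

lemma distribution_function_marshall_ratio:
  assumes \<phi>: "marshall_generator \<phi>" and F: "distribution_function F"
    and c: "filterlim (marshall_star \<phi>) at_top (at_right 0) \<or> (\<exists>x. F x = 0)"
  obtains G where "distribution_function G" "\<And>x. F x > 0 \<Longrightarrow> G x = F x / \<phi> (F x)"
proof -
  have mono_F: "F x \<le> F y" if "x \<le> y" for x y
    using F that by (simp add: distribution_function_iff mono_def)
  note r = distribution_function_range[OF F]
  define R where "R = (\<lambda>x. marshall_ratio \<phi> (F x))"
  have R_mono: "R x \<le> R y" if "x \<le> y" for x y
    unfolding R_def using r mono_F[OF that] by (intro marshall_ratio_mono[OF \<phi>]) auto
  have R_nonneg: "0 \<le> R x" for x
    using marshall_ratio_mono[OF \<phi>, of 0 "F x"] marshall_ratio_0_nonneg[OF \<phi>] r[of x]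
    by (simp add: R_def)
  have R_cont: "continuous (at_right x) R" for x
    unfolding R_def using r[of x]
    by (intro continuous_at_right_compose_distribution_function[OF F]
        marshall_ratio_right_continuous[OF \<phi>]) auto
  have R_top: "(R \<longlongrightarrow> 1) at_top"
    unfolding R_def using marshall_ratio_bounds[OF \<phi>]
    by (intro tendsto_at_top_compose_distribution_function[OF F]) auto
  have R_pos: "R x = F x / \<phi> (F x)" if "F x > 0" for x
    using that by (simp add: R_def marshall_ratio_def)
  show ?thesis
  proof (cases "\<exists>x. F x = 0")
    case False
    then have "(R \<longlongrightarrow> 0) at_bot"
      using tendsto_at_bot_compose_distribution_function[OF F marshall_ratio_right_continuous[OF \<phi>, of 0]]
        marshall_ratio_0_eq_0[OF \<phi>] c by (simp add: R_def)
    then have "distribution_function R"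
      using R_mono R_cont R_top by (simp add: distribution_function_iff mono_def)
    then show ?thesis using that R_pos by blast
  next
    case True
    then obtain x0 where x0: "F x0 = 0" by auto
    \<comment> \<open>\<open>F\<close> vanishes up to \<open>x0\<close>, so the cut changes no
      prescribed value. The strict inequality leaves \<open>R x0\<close> at \<open>x0\<close> and
      keeps \<open>G\<close> right continuous.\<close>
    define G where "G = (\<lambda>x. if x < x0 then 0 else R x)"
    have "mono G"
      using R_mono R_nonneg by (auto simp: G_def mono_def)
    moreover have "continuous (at_right x) G" for x
    proof (cases "x < x0")
      case True
      then have "\<forall>\<^sub>F t in at_right x. G t = G x"
        using eventually_at_right_real[OF True] by (auto simp: G_def elim!: eventually_mono)
      then show ?thesis by (simp add: continuous_within tendsto_eventually)
    next
      case False
      then have "\<forall>\<^sub>F t in at_right x. R t = G t"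
        by (auto simp: G_def eventually_at_filter)
      then show ?thesis
        using R_cont[of x] False by (auto simp: continuous_within G_def cong: tendsto_cong)
    qed
    moreover have "(G \<longlongrightarrow> 0) at_bot"
      by (intro tendsto_eventually eventually_mono[OF eventually_gt_at_bot[of x0]])
         (simp add: G_def)
    moreover have "(G \<longlongrightarrow> 1) at_top"
      by (intro Lim_transform_eventually[OF R_top] eventually_mono[OF eventually_ge_at_top[of x0]])
         (simp add: G_def)
    ultimately have "distribution_function G"
      by (simp add: distribution_function_iff)
    moreover have "G x = F x / \<phi> (F x)" if "F x > 0" for x
      using that x0 mono_F[of x x0] by (cases "x < x0") (auto simp: G_def R_pos)
    ultimately show ?thesis using that by blast
  qed
qed

section \<open>Comonotonic coupling and independence on product spaces\<close>

text \<open>Both generalised inverses are applied to the same uniform variable \<omega> on (0,1).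
  The inverse of \<open>G\<close> is at most \<open>x\<close> iff \<omega> is at most
  \<open>G x\<close>, and likewise for \<open>H\<close>, so the two events are nested and their
  intersection has the smaller probability.\<close>

lemma comonotonic_coupling:
  assumes "distribution_function G" "distribution_function H"
  obtains W :: "(real \<times> real) measure" where "prob_space W" "sets W = sets (borel \<Otimes>\<^sub>M borel)"
    "\<And>x y. measure W ({..x} \<times> {..y}) = min (G x) (H y)"
    "\<And>x. measure W ({..x} \<times> UNIV) = G x" "\<And>y. measure W (UNIV \<times> {..y}) = H y"
proof -
  obtain \<mu> \<nu> where "real_distribution \<mu>" "real_distribution \<nu>" and GH: "G = cdf \<mu>" "H = cdf \<nu>"
    using assms by (auto simp: distribution_function_def)
  then interpret \<mu>: cdf_distribution \<mu> + \<nu>: cdf_distribution \<nu>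
    by (simp_all add: cdf_distribution_def)
  let ?\<Omega> = "restrict_space lborel {0<..<1} :: real measure"
  let ?Q = "\<lambda>\<omega>. (\<mu>.I \<omega>, \<nu>.I \<omega>)"
  let ?W = "distr ?\<Omega> (borel \<Otimes>\<^sub>M borel) ?Q"
  have \<Omega>: "prob_space ?\<Omega>"
    by (auto simp add: emeasure_restrict_space space_restrict_space intro!: prob_spaceI)
  have Q: "?Q \<in> measurable ?\<Omega> (borel \<Otimes>\<^sub>M borel)"
    using \<mu>.measurable_CI \<nu>.measurable_CI
    by (intro measurable_Pair) (auto cong: measurable_cong_sets simp: sets_restrict_space)
  show ?thesis
  proof
    show "prob_space ?W" by (rule prob_space.prob_space_distr[OF \<Omega> Q])
    show "sets ?W = sets (borel \<Otimes>\<^sub>M borel)" by simp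
    \<comment> \<open>All three formulas are instances of this one: the preimage of \<open>S\<close>
      is the part of (0,1) up to \<open>m\<close>, which has length \<open>m\<close>.\<close>
    have W: "measure ?W S = m"
      if S: "S \<in> sets (borel \<Otimes>\<^sub>M borel)" and m: "m \<in> {0..1}"
        and iff: "\<And>\<omega>. \<omega> \<in> {0<..<1} \<Longrightarrow> ?Q \<omega> \<in> S \<longleftrightarrow> \<omega> \<le> m" for S m
    proof -
      have "measure ?W S = measure ?\<Omega> (?Q -` S \<inter> space ?\<Omega>)"
        by (intro measure_distr[OF Q] S)
      also have "?Q -` S \<inter> space ?\<Omega> = {\<omega>\<in>{0<..<1}. \<omega> \<le> m}"
        using iff by (auto simp: space_restrict_space)
      also have "measure ?\<Omega> \<dots> = measure lborel {\<omega>\<in>{0<..<1}. \<omega> \<le> m}"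
        by (intro measure_restrict_space) auto
      \<comment> \<open>Dropping the null point \<open>m\<close> gives an open interval for every
        \<open>m\<close>, including the extreme values 0 and 1.\<close>
      also have "\<dots> = measure lborel {0<..<m}"
      proof (rule measure_eq_AE)
        show "AE \<omega> in lborel. \<omega> \<in> {\<omega>\<in>{0<..<1}. \<omega> \<le> m} \<longleftrightarrow> \<omega> \<in> {0<..<m}"
          using AE_lborel_singleton[of m] by eventually_elim (use m in auto)
      qed auto
      finally show ?thesis using m by simp
    qed
    fix x y
    have r: "G x \<in> {0..1}" "H y \<in> {0..1}"
      using distribution_function_range[OF assms(1), of x] distribution_function_range[OF assms(2), of y] .
    show "measure ?W ({..x} \<times> {..y}) = min (G x) (H y)"
      using r by (intro W) (auto simp: GH \<mu>.pseudoinverse[symmetric] \<nu>.pseudoinverse[symmetric])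
    show "measure ?W ({..x} \<times> UNIV) = G x"
      using r by (intro W) (auto simp: GH \<mu>.pseudoinverse[symmetric])
    show "measure ?W (UNIV \<times> {..y}) = H y"
      using r by (intro W) (auto simp: GH \<nu>.pseudoinverse[symmetric])
  qed
qed

lemma measure_pair_pair_Times:
  assumes "prob_space A" "prob_space B" "prob_space C"
    and "a \<in> sets A" "b \<in> sets B" "c \<in> sets C"
  shows "measure (A \<Otimes>\<^sub>M (B \<Otimes>\<^sub>M C)) (a \<times> b \<times> c) = measure A a * measure B b * measure C c"
proof -
  interpret A: prob_space A by fact
  interpret B: prob_space B by fact
  interpret C: prob_space C by fact
  interpret BC: prob_space "B \<Otimes>\<^sub>M C" using assms by (intro prob_space_pair)
  show ?thesis
    using assms
    by (simp add: measure_def BC.emeasure_pair_measure_Times C.emeasure_pair_measure_Times enn2real_mult mult.assoc)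
qed

text \<open>Events of the three variables are cylinders that intersect in a box. With
  \<open>C\<close> the law of a pair and \<open>h\<close> either projection, this serves both Z1 and
  Z2.\<close>

lemma indep3_pair_pair:
  fixes A :: "'a measure" and B :: "'b measure" and C :: "'c measure"
  assumes A: "prob_space A" and B: "prob_space B" and C: "prob_space C"
    and [measurable]: "f \<in> borel_measurable A" "g \<in> borel_measurable B" "h \<in> borel_measurable C"
  shows "indep3 (A \<Otimes>\<^sub>M (B \<Otimes>\<^sub>M C)) (\<lambda>\<omega>. f (fst \<omega>)) (\<lambda>\<omega>. g (fst (snd \<omega>))) (\<lambda>\<omega>. h (snd (snd \<omega>)))"
proof -
  let ?M = "A \<Otimes>\<^sub>M (B \<Otimes>\<^sub>M C)"
  interpret A: prob_space A by fact
  interpret B: prob_space B by fact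
  interpret C: prob_space C by fact
  interpret prob_space ?M using A B C by (intro prob_space_pair)
  let ?Z = "\<lambda>i. [\<lambda>\<omega>. f (fst \<omega>), \<lambda>\<omega>. g (fst (snd \<omega>)), \<lambda>\<omega>. h (snd (snd \<omega>))] ! i"
  have rv: "random_variable borel (?Z i)" if "i \<in> {..<3}" for i
    using that by (auto simp: numeral_3_eq_3 less_Suc_eq)
  have "prob (\<Inter>j\<in>{..<3}. ?Z j -` S j \<inter> space ?M) = (\<Prod>j\<in>{..<3}. prob (?Z j -` S j \<inter> space ?M))"
    if "S \<in> (\<Pi> i\<in>{..<3::nat}. sets borel)" for S
  proof -
    define a b c where "a = f -` S 0 \<inter> space A" and "b = g -` S 1 \<inter> space B" and "c = h -` S 2 \<inter> space C"
    have [measurable]: "S 0 \<in> sets borel" "S 1 \<in> sets borel" "S 2 \<in> sets borel"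
      using that by auto
    have m: "a \<in> sets A" "b \<in> sets B" "c \<in> sets C"
      unfolding a_def b_def c_def by measurable
    have prod3: "(\<Prod>j\<in>{..<3}. P j) = P 0 * P 1 * P 2" for P :: "nat \<Rightarrow> real"
      by (simp add: eval_nat_numeral)
    have INT3: "(\<Inter>j\<in>{..<3}. P j) = P 0 \<inter> P 1 \<inter> P 2" for P :: "nat \<Rightarrow> ('a \<times> 'b \<times> 'c) set"
      by (auto simp: eval_nat_numeral less_Suc_eq)
    have 0: "?Z 0 -` S 0 \<inter> space ?M = a \<times> space B \<times> space C"
      and 1: "?Z 1 -` S 1 \<inter> space ?M = space A \<times> b \<times> space C"
      and 2: "?Z 2 -` S 2 \<inter> space ?M = space A \<times> space B \<times> c"
      by (auto simp: a_def b_def c_def space_pair_measure)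
    have I: "(\<Inter>j\<in>{..<3}. ?Z j -` S j \<inter> space ?M) = a \<times> b \<times> c"
      unfolding INT3 0 1 2 using m[THEN sets.sets_into_space] by auto
    show ?thesis
      unfolding I prod3 0 1 2
      using m A.prob_space B.prob_space C.prob_space by (simp add: measure_pair_pair_Times A B C)
  qed
  \<comment> \<open>The generator is the family of all Borel sets, which is stable under
    intersection and contains the whole line, so the product formula over the full index set
    suffices.\<close>
  then have "indep_vars (\<lambda>_. borel) ?Z {..<3}"
    using rv by (subst indep_vars_finite[where E="\<lambda>_. sets borel"])
      (auto simp: sets.sigma_sets_eq[of borel, simplified] Int_stable_def lessThan_empty_iff
        simp del: sets.sigma_sets_eq)
  then show ?thesis by (simp add: indep3_def)
qed

section \<open>Factorisation of the copula and construction of the random variables\<close>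

text \<open>If \<open>u\<close> or \<open>v\<close> is 0, both sides vanish whatever
  \<open>s\<close> and \<open>t\<close> are; hence these are prescribed only at positive arguments.
  Otherwise the product is moved inside the minimum.\<close>

lemma marshall_copula_eq_mult:
  assumes \<phi>: "marshall_generator \<phi>" and \<psi>: "marshall_generator \<psi>"
    and u: "u \<in> {0..1}" and v: "v \<in> {0..1}"
    and s: "u > 0 \<Longrightarrow> s = u / \<phi> u" and t: "v > 0 \<Longrightarrow> t = v / \<psi> v"
  shows "marshall_copula \<phi> \<psi> u v = \<phi> u * \<psi> v * min s t"
proof (cases "u = 0 \<or> v = 0")
  case True
  then show ?thesis
    using \<phi> \<psi> by (auto simp: marshall_copula_def marshall_generator_def)
next
  case False
  then have "u > 0" "v > 0" using u v by auto
  then have "0 < \<phi> u" "0 < \<psi> v" 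
    using marshall_generator_bounds(3)[OF \<phi>] marshall_generator_bounds(3)[OF \<psi>] u v by auto
  then show ?thesis
    using s[OF \<open>u > 0\<close>] t[OF \<open>v > 0\<close>]
    by (simp add: marshall_copula_def min_mult_distrib_left mult.commute)
qed

theorem theorem4:
  fixes \<phi> \<psi> F_U F_V :: "real \<Rightarrow> real"
  assumes "marshall_generator \<phi>" and "marshall_generator \<psi>"
    and "distribution_function F_U" and "distribution_function F_V"
    and a: "\<exists>h :: real \<Rightarrow> real. mono h \<and>
          (\<forall>x. F_U (h x) > 0 \<and> F_V x > 0 \<longrightarrow>
               marshall_star \<phi> (F_U (h x)) = marshall_star \<psi> (F_V x))"
    and b_U: "continuous (at 0 within {0..1}) \<phi> \<or>
          left_endpoint F_U > -\<infinity> \<and> \<not> isCont F_U (real_of_ereal (left_endpoint F_U))"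
    and b_V: "continuous (at 0 within {0..1}) \<psi> \<or>
          left_endpoint F_V > -\<infinity> \<and> \<not> isCont F_V (real_of_ereal (left_endpoint F_V))"
    and c_U: "filterlim (marshall_star \<phi>) at_top (at_right 0) \<or> (\<exists>x. F_U x = 0)"
    and c_V: "filterlim (marshall_star \<psi>) at_top (at_right 0) \<or> (\<exists>x. F_V x = 0)"
  shows "\<exists>(M :: (real \<times> real \<times> real \<times> real) measure) X Y Z1 Z2.
          prob_space M \<and>
          X \<in> borel_measurable M \<and> Y \<in> borel_measurable M \<and>
          Z1 \<in> borel_measurable M \<and> Z2 \<in> borel_measurable M \<and>
          indep3 M X Y Z1 \<and> indep3 M X Y Z2 \<and> comonotonic M Z1 Z2 \<and>
          (\<forall>x y. joint_cdf M (\<lambda>\<omega>. max (X \<omega>) (Z1 \<omega>)) (\<lambda>\<omega>. max (Y \<omega>) (Z2 \<omega>)) x y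
                 = marshall_copula \<phi> \<psi> (F_U x) (F_V y))"
proof -
  let ?Fx = "\<lambda>x. \<phi> (F_U x)" and ?Fy = "\<lambda>y. \<psi> (F_V y)"
  obtain A B where "real_distribution A" "real_distribution B"
    and cdfA: "?Fx = cdf A" and cdfB: "?Fy = cdf B"
    using distribution_function_marshall_generator[OF assms(1,3) b_U]
      distribution_function_marshall_generator[OF assms(2,4) b_V]
    unfolding distribution_function_def by blast
  then interpret A: real_distribution A + B: real_distribution B by simp_all
  obtain G where G: "distribution_function G" "\<And>x. F_U x > 0 \<Longrightarrow> G x = F_U x / \<phi> (F_U x)"
    using distribution_function_marshall_ratio[OF assms(1,3) c_U] by metis
  obtain H where H: "distribution_function H" "\<And>x. F_V x > 0 \<Longrightarrow> H x = F_V x / \<psi> (F_V x)"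
    using distribution_function_marshall_ratio[OF assms(2,4) c_V] by metis
  obtain W where "prob_space W" and [measurable_cong]: "sets W = sets (borel \<Otimes>\<^sub>M borel)"
    and W: "\<And>x y. measure W ({..x} \<times> {..y}) = min (G x) (H y)"
    "\<And>x. measure W ({..x} \<times> UNIV) = G x" "\<And>y. measure W (UNIV \<times> {..y}) = H y"
    using comonotonic_coupling[OF G(1) H(1)] by metis
  then interpret W: prob_space W by simp
  have [simp]: "space W = UNIV"
    using sets_eq_imp_space_eq[OF \<open>sets W = _\<close>] by (simp add: space_pair_measure)
  \<comment> \<open>The third factor is the joint law of (Z1, Z2), so X and Y are independent of the
    pair while Z1 and Z2 remain coupled.\<close>
  define M where "M = A \<Otimes>\<^sub>M (B \<Otimes>\<^sub>M W)"
  interpret M: prob_space M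
    unfolding M_def by (intro prob_space_pair A.prob_space_axioms B.prob_space_axioms W.prob_space_axioms)
  have [simp]: "space M = UNIV"
    by (simp add: M_def space_pair_measure)
  let ?X = "\<lambda>\<omega>::real \<times> real \<times> real \<times> real. fst \<omega>"
  let ?Y = "\<lambda>\<omega>::real \<times> real \<times> real \<times> real. fst (snd \<omega>)"
  let ?Z1 = "\<lambda>\<omega>::real \<times> real \<times> real \<times> real. fst (snd (snd \<omega>))"
  let ?Z2 = "\<lambda>\<omega>::real \<times> real \<times> real \<times> real. snd (snd (snd \<omega>))"
  have meas [measurable]: "?X \<in> borel_measurable M" "?Y \<in> borel_measurable M"
    "?Z1 \<in> borel_measurable M" "?Z2 \<in> borel_measurable M"
    unfolding M_def by measurable
  note probs = A.prob_space_axioms B.prob_space_axioms W.prob_space_axioms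
  have indep: "indep3 M ?X ?Y ?Z1" "indep3 M ?X ?Y ?Z2"
    unfolding M_def by (intro indep3_pair_pair probs; measurable)+
  have M_Times: "measure M ({..x} \<times> {..y} \<times> S) = \<phi> (F_U x) * \<psi> (F_V y) * measure W S"
    if "S \<in> sets W" for x y S
    using that fun_cong[OF cdfA, of x] fun_cong[OF cdfB, of y]
    by (simp add: M_def measure_pair_pair_Times[OF probs] cdf_def)
  have M_W: "measure M {\<omega>. snd (snd \<omega>) \<in> S} = measure W S" if "S \<in> sets W" for S
  proof -
    \<comment> \<open>As a cylinder, the event gets total mass 1 from each of the first two
      factors.\<close>
    have "{\<omega>. snd (snd \<omega>) \<in> S} = space A \<times> space B \<times> S"
      by auto
    then show ?thesis
      using that A.prob_space B.prob_space
      by (simp only: M_def measure_pair_pair_Times[OF probs] sets.top)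
  qed
  have "comonotonic M ?Z1 ?Z2"
    unfolding comonotonic_def
  proof (intro allI)
    fix x y
    have "cdf (distr M borel ?Z1) x = G x" "cdf (distr M borel ?Z2) y = H y"
      using M_W[of "{..x} \<times> UNIV"] M_W[of "UNIV \<times> {..y}"]
      by (auto simp: cdf_def measure_distr W vimage_def mem_Times_iff \<open>sets W = _\<close>)
    moreover have "joint_cdf M ?Z1 ?Z2 x y = min (G x) (H y)"
      using M_W[of "{..x} \<times> {..y}"] by (simp add: joint_cdf_def W mem_Times_iff \<open>sets W = _\<close>)
    ultimately show "joint_cdf M ?Z1 ?Z2 x y =
        min (cdf (distr M borel ?Z1) x) (cdf (distr M borel ?Z2) y)"
      by simp
  qed
  moreover have "joint_cdf M (\<lambda>\<omega>. max (?X \<omega>) (?Z1 \<omega>)) (\<lambda>\<omega>. max (?Y \<omega>) (?Z2 \<omega>)) x y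
      = marshall_copula \<phi> \<psi> (F_U x) (F_V y)" for x y
  proof -
    \<comment> \<open>A maximum is at most a bound iff both arguments are, so the event is a box and
      its probability factorises.\<close>
    have "{\<omega> \<in> space M. max (?X \<omega>) (?Z1 \<omega>) \<le> x \<and> max (?Y \<omega>) (?Z2 \<omega>) \<le> y}
        = {..x} \<times> {..y} \<times> ({..x} \<times> {..y})"
      by auto
    then have "joint_cdf M (\<lambda>\<omega>. max (?X \<omega>) (?Z1 \<omega>)) (\<lambda>\<omega>. max (?Y \<omega>) (?Z2 \<omega>)) x y
        = \<phi> (F_U x) * \<psi> (F_V y) * min (G x) (H y)"
      by (simp add: joint_cdf_def M_Times W \<open>sets W = _\<close>)
    also have "\<dots> = marshall_copula \<phi> \<psi> (F_U x) (F_V y)"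
      using distribution_function_range[OF assms(3), of x] distribution_function_range[OF assms(4), of y] G(2) H(2)
      by (intro marshall_copula_eq_mult[OF assms(1,2), symmetric]) auto
    finally show ?thesis .
  qed
  ultimately show ?thesis
    using M.prob_space_axioms meas indep by blast
qed

end
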